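(* Let $\mathbf{w}$ be any vector of entitlements. Then, for any positive constant $z$, there exists an algorithm that decides whether a connected allocation exists for $n$ agents in which each agent $i$ receives a piece with value more than $w_i+z$, using at most $n\cdot 2^{n-1}$ queries.
   Context: The cake is $C=[0,1]$, to be divided among agents $[n]$. Each agent $i$ has a valuation function $V_i$ on the algebra generated by intervals of $C$ that is non-negative, finitely additive, normalized ($V_i(C)=1$), with $x\mapsto V_i([0,x])$ continuous. Entitlements are $w_i>0$ with $\sum_i w_i=1$. An allocation is a partition $C=X_1\sqcup\cdots\sqcup X_n$ into finite unions of closed intervals, pairwise disjoint except possibly at endpoints, with $X_i$ given to agent $i$; it is connected if each $X_i$ is a single interval. Algorithms access valuations only via queries (each counts as one): $\textsc{Eval}_i(x,y)=V_i([x,y])$; $\textsc{Mark}_i(x,r)$ returns the largest $z\in C$ with $V_i([x,z])=r$, or $\infty$ if $V_i([x,1])<r$. *)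

theory Defs
  imports "HOL-Analysis.Analysis"
begin

definition cake :: "real set" where
  "cake = {0..1}"

definition cake_algebra :: "real set set" where
  "cake_algebra = \<Inter>{M. algebra cake M \<and> {I. is_interval I \<and> I \<subseteq> cake} \<subseteq> M}"

text \<open>Only the values on \<^const>\<open>cake_algebra\<close> matter. Continuity is required on \<open>(-\<infinity>, 1]\<close>
  and not just on \<open>[0, 1]\<close>: for \<open>x < 0\<close> the interval \<open>{0..x}\<close> is empty, so this is continuity of
  the distribution function including at its left end. It rules out an atom at \<open>0\<close>, which continuity
  on \<open>[0, 1]\<close> would allow and with which Mark queries starting at \<open>0\<close> would not be well defined.\<close>

definition valuation :: "(real set \<Rightarrow> real) \<Rightarrow> bool" where
  "valuation v \<longleftrightarrow>
     (\<forall>A\<in>cake_algebra. 0 \<le> v A) \<and>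
     additive cake_algebra v \<and>
     v cake = 1 \<and>
     continuous_on {..1} (\<lambda>x. v {0..x})"

definition entitlements :: "nat \<Rightarrow> (nat \<Rightarrow> real) \<Rightarrow> bool" where
  "entitlements n w \<longleftrightarrow> (\<forall>i\<in>{1..n}. 0 < w i) \<and> (\<Sum>i=1..n. w i) = 1"

definition closed_interval :: "real set \<Rightarrow> bool" where
  "closed_interval I \<longleftrightarrow> (\<exists>a b. a \<le> b \<and> I = {a..b})"

text \<open>The frontier of a finite union of closed intervals of the real line consists of the endpoints
  of its maximal intervals.\<close>

definition allocation :: "nat \<Rightarrow> (nat \<Rightarrow> real set) \<Rightarrow> bool" where
  "allocation n X \<longleftrightarrow>
     (\<forall>i\<in>{1..n}. \<exists>F. finite F \<and> (\<forall>I\<in>F. closed_interval I) \<and> X i = \<Union>F) \<and>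
     (\<Union>i\<in>{1..n}. X i) = cake \<and>
     (\<forall>i\<in>{1..n}. \<forall>j\<in>{1..n}. i \<noteq> j \<longrightarrow> X i \<inter> X j \<subseteq> frontier (X i) \<inter> frontier (X j))"

definition connected_allocation :: "nat \<Rightarrow> (nat \<Rightarrow> real set) \<Rightarrow> bool" where
  "connected_allocation n X \<longleftrightarrow> allocation n X \<and> (\<forall>i\<in>{1..n}. closed_interval (X i))"

definition eval_answer :: "(real set \<Rightarrow> real) \<Rightarrow> real \<Rightarrow> real \<Rightarrow> real" where
  "eval_answer v x y = v {x..y}"

definition mark_answer :: "(real set \<Rightarrow> real) \<Rightarrow> real \<Rightarrow> real \<Rightarrow> ereal" where
  "mark_answer v x r =
     (if v {x..1} < r then \<infinity> else ereal (GREATEST u. u \<in> {x..1} \<and> v {x..u} = r))"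

text \<open>A deterministic adaptive query algorithm is a well-founded tree: a node asks a query
  of the agent given by its first argument, and its last argument maps the answer to the rest of
  the computation. Computation between queries is free.\<close>

datatype algorithm =
    Decide bool
  | Eval nat real real "real \<Rightarrow> algorithm"
  | Mark nat real real "ereal \<Rightarrow> algorithm"

primrec decision :: "(nat \<Rightarrow> real set \<Rightarrow> real) \<Rightarrow> algorithm \<Rightarrow> bool" where
  "decision V (Decide b) = b"
| "decision V (Eval i x y k) = decision V (k (eval_answer (V i) x y))"
| "decision V (Mark i x r k) = decision V (k (mark_answer (V i) x r))"

primrec queries :: "(nat \<Rightarrow> real set \<Rightarrow> real) \<Rightarrow> algorithm \<Rightarrow> nat" where
  "queries V (Decide b) = 0"
| "queries V (Eval i x y k) = Suc (queries V (k (eval_answer (V i) x y)))"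
| "queries V (Mark i x r k) = Suc (queries V (k (mark_answer (V i) x r)))"

text \<open>Every query made in the run on \<open>V\<close> is meaningful: it addresses one of the \<open>n\<close> agents, its
  points lie in the cake, and a Mark query asks for a non-negative value.\<close>

primrec legal :: "nat \<Rightarrow> (nat \<Rightarrow> real set \<Rightarrow> real) \<Rightarrow> algorithm \<Rightarrow> bool" where
  "legal n V (Decide b) \<longleftrightarrow> True"
| "legal n V (Eval i x y k) \<longleftrightarrow>
     i \<in> {1..n} \<and> x \<in> cake \<and> y \<in> cake \<and> x \<le> y \<and> legal n V (k (eval_answer (V i) x y))"
| "legal n V (Mark i x r k) \<longleftrightarrow>
     i \<in> {1..n} \<and> x \<in> cake \<and> 0 \<le> r \<and> legal n V (k (mark_answer (V i) x r))"

end

theory Submission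
  imports Defs
begin

text \<open>Dynamic programming over sets of agents. For a set \<open>S\<close> let \<open>f S\<close> be the infimum of the \<open>t\<close> for
  which \<open>[0, t]\<close> can be cut into pieces satisfying every agent of \<open>S\<close>. Conditioning on the agent
  \<open>i\<close> who gets the rightmost piece, and using that Mark returns the \<^emph>\<open>largest\<close> solution, \<open>f S\<close> is the
  minimum over \<open>i \<in> S\<close> of \<open>Mark\<^sub>i(f(S - {i}), w\<^sub>i + z)\<close>. Hence \<open>f\<close> is computed, in order of increasing
  cardinality, with \<open>\<Sum>\<^sub>S |S| = n * 2 ^ (n - 1)\<close> queries, and a suitable allocation exists iff
  \<open>f {1..n} < 1\<close>: the requirement is strict, so the infimum is never attained.\<close>

section \<open>Valuations of intervals\<close>

lemma interval_in_cake_algebra: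
  assumes "is_interval I" "I \<subseteq> cake"
  shows "I \<in> cake_algebra"
  using assms unfolding cake_algebra_def by blast

lemma valuation_nonneg:
  assumes "valuation v" "is_interval I" "I \<subseteq> cake"
  shows "0 \<le> v I"
  using assms interval_in_cake_algebra unfolding valuation_def by blast

lemma valuation_Un:
  assumes "valuation v" "is_interval I" "I \<subseteq> cake" "is_interval J" "J \<subseteq> cake" "I \<inter> J = {}"
  shows "v (I \<union> J) = v I + v J"
  using assms interval_in_cake_algebra unfolding valuation_def additive_def by blast

lemma valuation_empty:
  assumes "valuation v"
  shows "v {} = 0"
  using valuation_Un[OF assms, of "{}" "{}"] by simp

text \<open>No order of \<open>x\<close> and \<open>y\<close> is assumed, as an empty inner interval
  has value 0. Comparisons at a point \<open>t\<close> to the left of \<open>x\<close> rely on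
  this.\<close>

lemma valuation_mono:
  assumes v: "valuation v" and "0 \<le> x'" "x' \<le> x" "y \<le> y'" "y' \<le> 1"
  shows "v {x..y} \<le> v {x'..y'}"
proof (cases "x \<le> y")
  case True
  have "v ({x..y} \<union> {y<..y'}) = v {x..y} + v {y<..y'}"
    by (rule valuation_Un[OF v])
      (use True assms in \<open>auto simp: cake_def is_interval_1\<close>)
  moreover have "{x..y} \<union> {y<..y'} = {x..y'}" using True assms by auto
  moreover have "v ({x'..<x} \<union> {x..y'}) = v {x'..<x} + v {x..y'}"
    by (rule valuation_Un[OF v])
      (use True assms in \<open>auto simp: cake_def is_interval_1\<close>)
  moreover have "{x'..<x} \<union> {x..y'} = {x'..y'}" using True assms by auto
  moreover have "0 \<le> v {y<..y'}" "0 \<le> v {x'..<x}"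
    using assms True
    by (auto intro!: valuation_nonneg[OF v] simp: cake_def is_interval_1)
  ultimately show ?thesis by simp
next
  case False
  then show ?thesis
    using assms valuation_empty[OF v] valuation_nonneg[OF v, of "{x'..y'}"]
    by (auto simp: cake_def is_interval_cc)
qed

text \<open>A point of positive value would be a jump of the distribution function: its values to
  the left of \<open>x\<close> are at most \<open>v {0..x} - v {x}\<close>, hence so is their limit
  \<open>v {0..x}\<close>. At \<open>x = 0\<close> those values belong to empty sets.\<close>

lemma valuation_singleton:
  assumes v: "valuation v" and x: "0 \<le> x" "x \<le> 1"
  shows "v {x} = 0"
proof -
  have "continuous_on {..1} (\<lambda>x. v {0..x})" using v unfolding valuation_def by blast
  then have "((\<lambda>u. v {0..u}) \<longlongrightarrow> v {0..x}) (at x within {..1})"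
    using x by (auto simp: continuous_on_def)
  then have lim: "((\<lambda>u. v {0..u}) \<longlongrightarrow> v {0..x}) (at_left x)"
    by (rule tendsto_within_subset) (use x in auto)
  have "v {0..u} \<le> v {0..x} - v {x}" if "u < x" for u
  proof -
    have "v ({0..<x} \<union> {x}) = v {0..<x} + v {x}"
      by (rule valuation_Un[OF v])
        (use x in \<open>auto simp: cake_def is_interval_1\<close>)
    moreover have "{0..<x} \<union> {x} = {0..x}" using x by auto
    moreover have "v ({0..u} \<union> ({0..<x} \<inter> {u<..})) = v {0..u} + v ({0..<x} \<inter> {u<..})"
      by (rule valuation_Un[OF v])
        (use x that in \<open>auto simp: cake_def is_interval_1\<close>)
    moreover have "{0..u} \<union> ({0..<x} \<inter> {u<..}) = {0..<x}" using that by auto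
    moreover have "0 \<le> v ({0..<x} \<inter> {u<..})"
      by (rule valuation_nonneg[OF v])
        (use x that in \<open>auto simp: cake_def is_interval_1\<close>)
    ultimately show ?thesis by simp
  qed
  then have "eventually (\<lambda>u. v {0..u} \<le> v {0..x} - v {x}) (at_left x)"
    by (auto simp: eventually_at_filter)
  from tendsto_upperbound[OF lim this] have "v {x} \<le> 0" by simp
  moreover have "0 \<le> v {x}"
    by (rule valuation_nonneg[OF v])
      (use x in \<open>auto simp: cake_def is_interval_1\<close>)
  ultimately show ?thesis by simp
qed

lemma valuation_interval:
  assumes v: "valuation v" and x: "0 \<le> x" "x \<le> y" "y \<le> 1"
  shows "v {x..y} = v {0..y} - v {0..x}"
proof -
  have "v ({0..x} \<union> {x<..y}) = v {0..x} + v {x<..y}"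
    by (rule valuation_Un[OF v])
      (use x in \<open>auto simp: cake_def is_interval_1\<close>)
  moreover have "{0..x} \<union> {x<..y} = {0..y}" using x by auto
  moreover have "v ({x} \<union> {x<..y}) = v {x} + v {x<..y}"
    by (rule valuation_Un[OF v])
      (use x in \<open>auto simp: cake_def is_interval_1\<close>)
  moreover have "{x} \<union> {x<..y} = {x..y}" using x by auto
  ultimately show ?thesis using valuation_singleton[OF v] x by simp
qed

lemma continuous_on_valuation_right:
  assumes v: "valuation v" and "0 \<le> x"
  shows "continuous_on {x..1} (\<lambda>u. v {x..u})"
proof -
  have "continuous_on {..1} (\<lambda>u. v {0..u})" using v unfolding valuation_def by blast
  then have "continuous_on {x..1} (\<lambda>u. v {0..u})" by (rule continuous_on_subset) auto
  then have "continuous_on {x..1} (\<lambda>u. v {0..u} - v {0..x})"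
    by (intro continuous_on_diff continuous_on_const)
  then show ?thesis
    by (rule continuous_on_eq) (rule valuation_interval[OF v, symmetric], use assms in auto)
qed

text \<open>A threshold is an infimum that need not be feasible itself, so a piece starting there
  must be made to start slightly later. The slack in the strict demand pays for this, since
  \<open>v {x..u}\<close> tends to 0 as \<open>u\<close> decreases to \<open>x\<close>.\<close>

lemma valuation_shrink_left:
  assumes v: "valuation v" and "0 \<le> x" "x < t" "t \<le> 1" and "r < v {x..t}"
  obtains s where "x < s" "s < t" "r < v {s..t}"
proof -
  have "((\<lambda>u. v {x..u}) \<longlongrightarrow> v {x..x}) (at x within {x..1})"
    using continuous_on_valuation_right[OF v \<open>0 \<le> x\<close>] assms
    unfolding continuous_on_def by (elim ballE[of _ _ x]) auto
  then have "((\<lambda>u. v {x..u}) \<longlongrightarrow> 0) (at_right x)"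
    using valuation_singleton[OF v, of x] assms at_within_Icc_at_right[of x 1] by simp
  then have "eventually (\<lambda>u. v {x..u} < v {x..t} - r) (at_right x)"
    by (rule order_tendstoD(2)) (use assms in simp)
  moreover have "eventually (\<lambda>u. x < u \<and> u < t) (at_right x)"
    using assms by (auto simp: eventually_at_right)
  ultimately have "eventually (\<lambda>u. v {x..u} < v {x..t} - r \<and> x < u \<and> u < t) (at_right x)"
    by (rule eventually_conj)
  then obtain s where s: "v {x..s} < v {x..t} - r" "x < s" "s < t"
    using eventually_happens'[OF trivial_limit_at_right_real] by auto
  then have "v {s..t} = v {x..t} - v {x..s}"
    using valuation_interval[OF v, of s t] valuation_interval[OF v, of x t]
      valuation_interval[OF v, of x s] assms by linarith
  then show thesis using that s by auto
qed

text \<open>This depends on Mark returning the largest solution: beyond it the value is at least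
  \<open>r\<close> by monotonicity and different from \<open>r\<close> by maximality, and up to it
  the value is at most \<open>r\<close>. The smallest solution would fail if a stretch of value 0
  followed it.\<close>

lemma mark_answer_less_iff:
  assumes v: "valuation v" and x: "0 \<le> x" "x \<le> 1" and r: "0 \<le> r" and t: "t \<le> 1"
  shows "mark_answer v x r < ereal t \<longleftrightarrow> r < v {x..t}"
proof (cases "v {x..1} < r")
  case True
  then show ?thesis using valuation_mono[OF v, of x x t 1] x t by (simp add: mark_answer_def)
next
  case False
  define U where "U = {u \<in> {x..1}. v {x..u} = r}"
  have cont: "continuous_on {x..1} (\<lambda>u. v {x..u})"
    by (rule continuous_on_valuation_right[OF v x(1)])
  have "\<exists>u\<ge>x. u \<le> 1 \<and> v {x..u} = r"
    using IVT'[of "\<lambda>u. v {x..u}" x r 1, OF _ _ _ cont] False x r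
      valuation_singleton[OF v x] by simp
  then have "U \<noteq> {}" by (auto simp: U_def)
  \<comment> \<open>A compact level set has a maximum, without which \<open>GREATEST\<close> would
    be unspecified.\<close>
  moreover have "compact U"
  proof -
    have "closed U"
      unfolding U_def by (rule continuous_closed_preimage_constant[OF cont closed_atLeastAtMost])
    moreover have "bounded U"
      by (rule bounded_subset[of "{x..1}"]) (auto simp: U_def)
    ultimately show ?thesis by (simp add: compact_eq_bounded_closed)
  qed
  ultimately obtain g where g: "g \<in> U" "\<And>u. u \<in> U \<Longrightarrow> u \<le> g"
    using compact_attains_sup[of U] by auto
  have "(GREATEST u. u \<in> {x..1} \<and> v {x..u} = r) = g"
    using g unfolding U_def by (intro Greatest_equality) simp_all
  then have m: "mark_answer v x r = ereal g" using False by (simp add: mark_answer_def)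
  show ?thesis
  proof (cases "g < t")
    case True
    then have "t \<notin> U" using g(2)[of t] by auto
    then have "v {x..t} \<noteq> r" using True g(1) t by (simp add: U_def)
    moreover have "v {x..g} \<le> v {x..t}" using valuation_mono[OF v, of x x g t] x t True by simp
    ultimately show ?thesis using True g(1) m by (simp add: U_def)
  next
    case False
    then have "v {x..t} \<le> v {x..g}" using valuation_mono[OF v, of x x t g] x g(1) by (simp add: U_def)
    then show ?thesis using False g(1) m by (simp add: U_def)
  qed
qed

section \<open>Serving a set of agents from an initial segment\<close>

text \<open>Gaps between the pieces are allowed, which makes the notion monotone in
  \<open>t\<close>; they are filled when a partition is built. Since the pieces are nondegenerate,
  the pairwise condition orders them from left to right.\<close>

definition packable :: "(nat \<Rightarrow> real set \<Rightarrow> real) \<Rightarrow> (nat \<Rightarrow> real) \<Rightarrow> nat set \<Rightarrow> real \<Rightarrow> bool" where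
  "packable V r S t \<longleftrightarrow>
     (\<exists>a b. (\<forall>i\<in>S. 0 \<le> a i \<and> a i < b i \<and> b i \<le> t \<and> r i < V i {a i..b i}) \<and>
            pairwise (\<lambda>i j. b i \<le> a j \<or> b j \<le> a i) S)"

lemma packable_mono:
  assumes "packable V r S s" "s \<le> t"
  shows "packable V r S t"
  using assms unfolding packable_def by (meson order_trans)

lemma packable_pos:
  assumes "packable V r S t" "S \<noteq> {}"
  shows "0 < t"
  using assms unfolding packable_def by force

text \<open>The agent \<open>i\<close> is the one who receives the rightmost piece.\<close>

lemma packable_iff_last:
  assumes "finite S" "S \<noteq> {}" and v: "\<And>i. i \<in> S \<Longrightarrow> valuation (V i)" and "t \<le> 1"
  shows "packable V r S t \<longleftrightarrow>
    (\<exists>i\<in>S. \<exists>s. 0 \<le> s \<and> s < t \<and> packable V r (S - {i}) s \<and> r i < V i {s..t})"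
    (is "_ \<longleftrightarrow> ?R")
proof
  assume "packable V r S t"
  then obtain a b where
    ab: "\<And>i. i \<in> S \<Longrightarrow> 0 \<le> a i \<and> a i < b i \<and> b i \<le> t \<and> r i < V i {a i..b i}"
    and pw: "pairwise (\<lambda>i j. b i \<le> a j \<or> b j \<le> a i) S"
    unfolding packable_def by blast
  have "Max (b ` S) \<in> b ` S" using assms by simp
  then obtain i where i: "i \<in> S" "b i = Max (b ` S)" by force
  have max: "b j \<le> b i" if "j \<in> S" for j using i that assms by simp
  \<comment> \<open>Otherwise \<open>b i \<le> a j < b j\<close>, contrary to the maximality of
    \<open>b i\<close>.\<close>
  have le: "b j \<le> a i" if "j \<in> S - {i}" for j
    using pw i that max[of j] ab[of j] unfolding pairwise_def by force
  have "packable V r (S - {i}) (a i)"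
    unfolding packable_def
    by (rule exI[of _ a], rule exI[of _ b]) (use ab le pw in \<open>auto simp: pairwise_def\<close>)
  moreover have "V i {a i..b i} \<le> V i {a i..t}"
    using valuation_mono[OF v[OF i(1)]] ab[OF i(1)] assms by auto
  ultimately show ?R using ab[OF i(1)] i by force
next
  assume ?R
  then obtain i s where i: "i \<in> S" "0 \<le> s" "s < t" "packable V r (S - {i}) s" "r i < V i {s..t}"
    by blast
  then obtain a b where
    ab: "\<And>j. j \<in> S - {i} \<Longrightarrow> 0 \<le> a j \<and> a j < b j \<and> b j \<le> s \<and> r j < V j {a j..b j}"
    and pw: "pairwise (\<lambda>i j. b i \<le> a j \<or> b j \<le> a i) (S - {i})"
    unfolding packable_def by blast
  show "packable V r S t"
    unfolding packable_def
  proof (rule exI[of _ "a(i := s)"], rule exI[of _ "b(i := t)"], intro conjI ballI)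
    fix j assume "j \<in> S"
    then show "0 \<le> (a(i := s)) j" "(a(i := s)) j < (b(i := t)) j" "(b(i := t)) j \<le> t"
      "r j < V j {(a(i := s)) j..(b(i := t)) j}"
      using i ab[of j] by auto
  next
    show "pairwise (\<lambda>k j. (b(i := t)) k \<le> (a(i := s)) j \<or> (b(i := t)) j \<le> (a(i := s)) k) S"
      using ab pw by (auto simp: pairwise_def)
  qed
qed

text \<open>The gaps disappear by peeling off the last agent, who takes all of \<open>{s..t}\<close>
  while the others share \<open>{0..s}\<close>. The one agent left at the end has the piece
  stretched down to 0.\<close>

lemma packable_imp_partition:
  assumes "finite S" "S \<noteq> {}" "\<And>i. i \<in> S \<Longrightarrow> valuation (V i)" "t \<le> 1" "packable V r S t"
  shows "\<exists>X. (\<forall>i\<in>S. closed_interval (X i) \<and> r i < V i (X i)) \<and> (\<Union>i\<in>S. X i) = {0..t} \<and>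
    (\<forall>i\<in>S. \<forall>j\<in>S. i \<noteq> j \<longrightarrow> X i \<inter> X j \<subseteq> frontier (X i) \<inter> frontier (X j))"
  using assms
proof (induction S arbitrary: t rule: finite_psubset_induct)
  case (psubset S)
  obtain i s where i: "i \<in> S" "0 \<le> s" "s < t" "packable V r (S - {i}) s" "r i < V i {s..t}"
    using packable_iff_last[of S V t r] psubset.hyps psubset.prems by blast
  show ?case
  proof (cases "S = {i}")
    case True
    have "V i {s..t} \<le> V i {0..t}"
      using valuation_mono[of "V i" 0 s t t] i psubset.prems by auto
    then show ?thesis
      using True i by (intro exI[of _ "\<lambda>_. {0..t}"]) (auto simp: closed_interval_def)
  next
    case False
    then have ne: "S - {i} \<noteq> {}" using i by auto
    have s: "0 < s" using packable_pos[OF i(4) ne] .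
    have "S - {i} \<subset> S" using i by blast
    moreover have "s \<le> 1" using i psubset.prems by simp
    ultimately have "\<exists>X. (\<forall>j\<in>S - {i}. closed_interval (X j) \<and> r j < V j (X j)) \<and>
      (\<Union>j\<in>S - {i}. X j) = {0..s} \<and> (\<forall>j\<in>S - {i}. \<forall>k\<in>S - {i}. j \<noteq> k \<longrightarrow>
        X j \<inter> X k \<subseteq> frontier (X j) \<inter> frontier (X k))"
      using ne i(4) psubset.prems by (intro psubset.IH) simp_all
    then obtain X where X: "\<forall>j\<in>S - {i}. closed_interval (X j) \<and> r j < V j (X j)"
      "(\<Union>j\<in>S - {i}. X j) = {0..s}"
      "\<forall>j\<in>S - {i}. \<forall>k\<in>S - {i}. j \<noteq> k \<longrightarrow> X j \<inter> X k \<subseteq> frontier (X j) \<inter> frontier (X k)"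
      by (elim exE conjE)
    \<comment> \<open>The two pieces can meet only at \<open>s\<close>, the left end of one and,
      since \<open>X j\<close> lies in \<open>{0..s}\<close>, the right end of the other.\<close>
    have fr: "X j \<inter> {s..t} \<subseteq> frontier (X j) \<inter> frontier {s..t}" if j: "j \<in> S - {i}" for j
    proof
      fix y assume y: "y \<in> X j \<inter> {s..t}"
      have "X j \<subseteq> {0..s}" using X(2) j by blast
      then have "y = s" using y by auto
      obtain c d where cd: "X j = {c..d}" "c \<le> d"
        using X(1) j unfolding closed_interval_def by blast
      then have "d = s" using \<open>X j \<subseteq> {0..s}\<close> \<open>y = s\<close> y by auto
      then show "y \<in> frontier (X j) \<inter> frontier {s..t}"
        using cd \<open>y = s\<close> i(3) y
        by (simp add: frontier_def interior_atLeastAtMost_real)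
    qed
    define Y where "Y = X(i := {s..t})"
    have "(\<Union>j\<in>S. Y j) = (\<Union>j\<in>S - {i}. X j) \<union> {s..t}"
      using i(1) unfolding Y_def by auto
    also have "\<dots> = {0..t}" unfolding X(2) using s i(3) by auto
    finally have "(\<Union>j\<in>S. Y j) = {0..t}" .
    moreover have "\<forall>j\<in>S. closed_interval (Y j) \<and> r j < V j (Y j)"
      using X(1) i(3,5) by (auto simp: Y_def closed_interval_def)
    moreover have "\<forall>j\<in>S. \<forall>k\<in>S. j \<noteq> k \<longrightarrow> Y j \<inter> Y k \<subseteq> frontier (Y j) \<inter> frontier (Y k)"
    proof (intro ballI impI)
      fix j k assume "j \<in> S" "k \<in> S" "j \<noteq> k"
      then consider "j = i" "k \<in> S - {i}" | "k = i" "j \<in> S - {i}" | "j \<in> S - {i}" "k \<in> S - {i}"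
        by auto
      then show "Y j \<inter> Y k \<subseteq> frontier (Y j) \<inter> frontier (Y k)"
      proof cases
        case 1 then show ?thesis using fr[of k] unfolding Y_def by auto
      next
        case 2 then show ?thesis using fr[of j] unfolding Y_def by auto
      next
        case 3 then show ?thesis using X(3) \<open>j \<noteq> k\<close> unfolding Y_def by simp
      qed
    qed
    ultimately show ?thesis by blast
  qed
qed

section \<open>Connected allocations as packings\<close>

lemma intervals_meeting_in_frontier:
  fixes a b c d :: real
  assumes "{a..b} \<inter> {c..d} \<subseteq> frontier {a..b}" "a < b" "c < d"
  shows "b \<le> c \<or> d \<le> a"
proof (rule ccontr)
  assume "\<not> ?thesis"
  then have "max a c < min b d" using assms by auto
  then obtain y where "max a c < y" "y < min b d" using dense by blast
  then have "y \<in> {a..b} \<inter> {c..d}" "y \<notin> frontier {a..b}"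
    using interior_atLeastAtMost_real[of a b] by (auto simp: frontier_def)
  then show False using assms by blast
qed

text \<open>Demands are nonnegative and strict, so a single point, having value 0, serves nobody.
  All pieces thus have positive length, and meeting only in frontiers becomes an order of end
  points. Conversely, \<open>packable_imp_partition\<close> fills the gaps.\<close>

lemma connected_allocation_iff_packable:
  assumes n: "1 \<le> n" and v: "\<And>i. i \<in> {1..n} \<Longrightarrow> valuation (V i)" and r: "\<And>i. 0 \<le> r i"
  shows "(\<exists>X. connected_allocation n X \<and> (\<forall>i\<in>{1..n}. r i < V i (X i))) \<longleftrightarrow>
    packable V r {1..n} 1"
proof
  assume "\<exists>X. connected_allocation n X \<and> (\<forall>i\<in>{1..n}. r i < V i (X i))"
  then obtain X where X: "connected_allocation n X" "\<And>i. i \<in> {1..n} \<Longrightarrow> r i < V i (X i)"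
    by blast
  then have "\<forall>i\<in>{1..n}. \<exists>a b. a \<le> b \<and> X i = {a..b}"
    unfolding connected_allocation_def closed_interval_def by simp
  then obtain a b where ab: "\<And>i. i \<in> {1..n} \<Longrightarrow> a i \<le> b i \<and> X i = {a i..b i}"
    by metis
  have cov: "(\<Union>i\<in>{1..n}. X i) = {0..1}"
    using X(1) unfolding connected_allocation_def allocation_def cake_def by blast
  have in01: "0 \<le> a i" "b i \<le> 1" if "i \<in> {1..n}" for i
  proof -
    have "{a i..b i} \<subseteq> {0..1}" using cov ab[OF that] that by blast
    then show "0 \<le> a i" "b i \<le> 1" using ab[OF that] by simp_all
  qed
  have lt: "a i < b i" if "i \<in> {1..n}" for i
  proof (rule ccontr)
    assume "\<not> ?thesis"
    then have "a i = b i" using ab[OF that] by auto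
    then have "X i = {a i}" using ab[OF that] by auto
    then have "V i (X i) = 0"
      using valuation_singleton[OF v[OF that]] in01[OF that] \<open>a i = b i\<close> by simp
    then show False using X(2)[OF that] r[of i] by simp
  qed
  have "pairwise (\<lambda>i j. b i \<le> a j \<or> b j \<le> a i) {1..n}"
  proof (rule pairwiseI)
    fix i j assume ij: "i \<in> {1..n}" "j \<in> {1..n}" "i \<noteq> j"
    then have "X i \<inter> X j \<subseteq> frontier (X i)"
      using X(1) unfolding connected_allocation_def allocation_def by blast
    then have "{a i..b i} \<inter> {a j..b j} \<subseteq> frontier {a i..b i}"
      using ab[OF ij(1)] ab[OF ij(2)] by simp
    then show "b i \<le> a j \<or> b j \<le> a i"
      by (rule intervals_meeting_in_frontier[OF _ lt[OF ij(1)] lt[OF ij(2)]])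
  qed
  moreover have "r i < V i {a i..b i}" if "i \<in> {1..n}" for i
    using X(2)[OF that] ab[OF that] by simp
  ultimately show "packable V r {1..n} 1"
    unfolding packable_def
    by - (rule exI[of _ a], rule exI[of _ b], use in01 lt in simp)
next
  assume "packable V r {1..n} 1"
  then obtain X where X: "\<forall>i\<in>{1..n}. closed_interval (X i) \<and> r i < V i (X i)"
    "(\<Union>i\<in>{1..n}. X i) = {0..1}"
    "\<forall>i\<in>{1..n}. \<forall>j\<in>{1..n}. i \<noteq> j \<longrightarrow> X i \<inter> X j \<subseteq> frontier (X i) \<inter> frontier (X j)"
    using packable_imp_partition[of "{1..n}" V 1 r] n v by auto
  have "\<exists>F. finite F \<and> (\<forall>I\<in>F. closed_interval I) \<and> X i = \<Union>F" if "i \<in> {1..n}" for i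
    by (rule exI[of _ "{X i}"]) (use X(1) that in auto)
  then have "connected_allocation n X"
    unfolding connected_allocation_def allocation_def cake_def
    by (intro conjI ballI) (use X in simp_all)
  then show "\<exists>X. connected_allocation n X \<and> (\<forall>i\<in>{1..n}. r i < V i (X i))"
    using X(1) by blast
qed

section \<open>Thresholds\<close>

text \<open>Restricting to \<open>0 < t\<close> makes \<open>0\<close> the threshold of the empty set.\<close>

definition threshold :: "(nat \<Rightarrow> real set \<Rightarrow> real) \<Rightarrow> (nat \<Rightarrow> real) \<Rightarrow> nat set \<Rightarrow> ereal \<Rightarrow> bool" where
  "threshold V r S x \<longleftrightarrow> 0 \<le> x \<and> (\<forall>t. 0 < t \<and> t \<le> 1 \<longrightarrow> (packable V r S t \<longleftrightarrow> x < ereal t))"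

lemma threshold_empty: "threshold V r {} 0"
  by (auto simp: threshold_def packable_def pairwise_def)

text \<open>A start at or beyond 1 leaves no cake for the last agent; \<open>ask\<close> spends no
  query in this case.\<close>

definition cut :: "(nat \<Rightarrow> real set \<Rightarrow> real) \<Rightarrow> (nat \<Rightarrow> real) \<Rightarrow> nat \<Rightarrow> ereal \<Rightarrow> ereal" where
  "cut V r i x = (if x < 1 then mark_answer (V i) (real_of_ereal x) (r i) else \<infinity>)"

lemma cut_less_iff:
  assumes "valuation (V i)" "0 \<le> r i" "0 \<le> x" "t \<le> 1"
  shows "cut V r i x < ereal t \<longleftrightarrow> (\<exists>y. x = ereal y \<and> 0 \<le> y \<and> y < 1 \<and> r i < V i {y..t})"
  using assms mark_answer_less_iff[of "V i" _ "r i" t] unfolding cut_def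
  by (cases x) (auto simp: one_ereal_def)

text \<open>Marking from the infimum \<open>x\<close> accounts for every feasible start. The slack
  lets a piece from \<open>x\<close> begin slightly later, where \<open>S\<close> is served;
  conversely a feasible start \<open>s\<close> is at least \<open>x\<close>, and starting at
  \<open>x\<close> only gains value.\<close>

lemma threshold_cut:
  assumes v: "valuation (V i)" and r: "0 \<le> r i" and th: "threshold V r S x" and t: "t \<le> 1"
  shows "cut V r i x < ereal t \<longleftrightarrow> (\<exists>s. 0 \<le> s \<and> s < t \<and> packable V r S s \<and> r i < V i {s..t})"
proof
  assume "cut V r i x < ereal t"
  then obtain y where y: "x = ereal y" "0 \<le> y" "y < 1" "r i < V i {y..t}"
    using cut_less_iff[of V i r x t] assms by (auto simp: threshold_def)
  have "y < t"
  proof (rule ccontr)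
    assume "\<not> y < t"
    then have "V i {y..t} \<le> V i {y..y}" using valuation_mono[OF v, of y y t y] y by auto
    then show False using valuation_singleton[OF v, of y] y r by simp
  qed
  then obtain s where s: "y < s" "s < t" "r i < V i {s..t}"
    using valuation_shrink_left[OF v] y t by metis
  then have "packable V r S s" using th y t unfolding threshold_def by auto
  then show "\<exists>s. 0 \<le> s \<and> s < t \<and> packable V r S s \<and> r i < V i {s..t}"
    using s y by (intro exI[of _ s]) auto
next
  assume "\<exists>s. 0 \<le> s \<and> s < t \<and> packable V r S s \<and> r i < V i {s..t}"
  then obtain s where s: "0 \<le> s" "s < t" "packable V r S s" "r i < V i {s..t}" by blast
  \<comment> \<open>\<open>s\<close> may be 0, where \<open>threshold\<close> says nothing, so
    \<open>x\<close> is compared with all \<open>u\<close> above \<open>s\<close>.\<close>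
  have less: "x < ereal u" if "s < u" "u \<le> 1" for u
    using th packable_mono[OF s(3), of u] that s unfolding threshold_def by auto
  then have "x < ereal t" using s t by blast
  moreover have "0 \<le> x" using th by (simp add: threshold_def)
  ultimately obtain y where y: "x = ereal y" by (cases x) auto
  have "y \<le> s"
  proof (rule ccontr)
    assume "\<not> y \<le> s"
    then show False using less[of y] \<open>x < ereal t\<close> y t by auto
  qed
  then have "V i {s..t} \<le> V i {y..t}"
    using valuation_mono[OF v] \<open>0 \<le> x\<close> y t by auto
  then show "cut V r i x < ereal t"
    using cut_less_iff[of V i r x t] v r \<open>0 \<le> x\<close> y \<open>y \<le> s\<close> s t by auto
qed

lemma cut_nonneg:
  assumes "valuation (V i)" "0 \<le> r i" "0 \<le> x"
  shows "0 \<le> cut V r i x"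
proof (rule ccontr)
  assume "\<not> ?thesis"
  then have "cut V r i x < ereal 0" by (simp add: zero_ereal_def)
  then obtain y where "0 \<le> y" "y < 1" "r i < V i {y..0}"
    using cut_less_iff[of V i r x 0] assms by auto
  moreover have "V i {y..0} \<le> V i {y..y}" using valuation_mono[OF assms(1), of y y 0 y] calculation by auto
  ultimately show False using valuation_singleton[OF assms(1), of y] assms(2) by simp
qed

text \<open>The recurrence of the dynamic program: a minimum is below \<open>t\<close> iff some
  entry is, which matches the choice of the last agent.\<close>

lemma threshold_Min_cut:
  assumes S: "finite S" "S \<noteq> {}" and v: "\<And>i. i \<in> S \<Longrightarrow> valuation (V i)" and r: "\<And>i. 0 \<le> r i"
    and th: "\<And>i. i \<in> S \<Longrightarrow> threshold V r (S - {i}) (x i)"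
  shows "threshold V r S (Min ((\<lambda>i. cut V r i (x i)) ` S))"
proof -
  have "0 \<le> cut V r i (x i)" if "i \<in> S" for i
    using cut_nonneg v r th that by (simp add: threshold_def)
  moreover have "packable V r S t \<longleftrightarrow> (\<exists>i\<in>S. cut V r i (x i) < ereal t)" if "t \<le> 1" for t
    using packable_iff_last[OF S v that] threshold_cut[OF v r th that] by auto
  ultimately show ?thesis using S by (simp add: threshold_def Min_less_iff)
qed

section \<open>The algorithm\<close>

text \<open>Continuation-passing style: \<open>m\<close> carries the running minimum of the cuts,
  and \<open>k\<close> is the rest of the computation.\<close>

primrec ask :: "(nat \<Rightarrow> real) \<Rightarrow> (nat \<Rightarrow> ereal) \<Rightarrow> nat list \<Rightarrow> ereal \<Rightarrow> (ereal \<Rightarrow> algorithm) \<Rightarrow> algorithm"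
where
  "ask r x [] m k = k m"
| "ask r x (i # js) m k =
     (if x i < 1 then Mark i (real_of_ereal (x i)) (r i) (\<lambda>a. ask r x js (min m a) k)
      else ask r x js m k)"

primrec solve :: "(nat \<Rightarrow> real) \<Rightarrow> nat set \<Rightarrow> nat set list \<Rightarrow> (nat set \<Rightarrow> ereal) \<Rightarrow> algorithm" where
  "solve r A [] f = Decide (f A < 1)"
| "solve r A (S # Ss) f =
     ask r (\<lambda>i. f (S - {i})) (sorted_list_of_set S) \<infinity> (\<lambda>m. solve r A Ss (f(S := m)))"

lemma ask_correct:
  fixes V :: "nat \<Rightarrow> real set \<Rightarrow> real" and x :: "nat \<Rightarrow> ereal"
  assumes "set js \<subseteq> {1..n}" "\<And>i. 0 \<le> r i" "\<And>i. i \<in> set js \<Longrightarrow> 0 \<le> x i"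
  defines "M m \<equiv> Min (insert m ((\<lambda>i. cut V r i (x i)) ` set js))"
  shows "decision V (ask r x js m k) = decision V (k (M m))"
    and "queries V (ask r x js m k) \<le> length js + queries V (k (M m))"
    and "legal n V (k (M m)) \<Longrightarrow> legal n V (ask r x js m k)"
proof -
  have "decision V (ask r x js m k) = decision V (k (M m)) \<and>
    queries V (ask r x js m k) \<le> length js + queries V (k (M m)) \<and>
    (legal n V (k (M m)) \<longrightarrow> legal n V (ask r x js m k))"
    using assms(1,3) unfolding M_def
  proof (induction js arbitrary: m)
    case Nil
    then show ?case by simp
  next
    case (Cons i js)
    define c where "c = cut V r i (x i)"
    have M: "Min (insert m ((\<lambda>i. cut V r i (x i)) ` set (i # js))) =
      Min (insert (min m c) ((\<lambda>i. cut V r i (x i)) ` set js))"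
      by (cases "js = []") (auto simp: c_def min.assoc min.left_commute)
    show ?case
    proof (cases "x i < 1")
      case True
      then have c: "c = mark_answer (V i) (real_of_ereal (x i)) (r i)"
        by (simp add: c_def cut_def)
      have "0 \<le> x i" using Cons.prems by simp
      \<comment> \<open>This gives legality: a nonnegative start below 1 is finite and lies in the
        cake.\<close>
      then have "real_of_ereal (x i) \<in> cake"
        using True by (cases "x i") (auto simp: cake_def one_ereal_def zero_ereal_def)
      then show ?thesis
        unfolding M using Cons.IH[of "min m c"] Cons.prems True assms(2) c by auto
    next
      case False
      \<comment> \<open>The skipped agent has an infinite cut, so the minimum does not
        change.\<close>
      then have "min m c = m" by (simp add: c_def cut_def)
      then show ?thesis unfolding M using Cons.IH[of m] Cons.prems False by auto
    qed
  qed
  then show "decision V (ask r x js m k) = decision V (k (M m))"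
    and "queries V (ask r x js m k) \<le> length js + queries V (k (M m))"
    and "legal n V (k (M m)) \<Longrightarrow> legal n V (ask r x js m k)"
    by auto
qed

text \<open>The invariant is that the table \<open>f\<close> is right on all subsets outside the
  remaining list. Once the list is empty this covers \<open>{1..n}\<close>, and its threshold read
  at \<open>t = 1\<close> gives the decision.\<close>

lemma solve_correct:
  assumes v: "\<And>i. i \<in> {1..n} \<Longrightarrow> valuation (V i)" and r: "\<And>i. 0 \<le> r i"
    and "sorted (map card Ss)" "set Ss \<subseteq> Pow {1..n} - {{}}"
    and "\<And>T. T \<subseteq> {1..n} \<Longrightarrow> T \<notin> set Ss \<Longrightarrow> threshold V r T (f T)"
  shows "legal n V (solve r {1..n} Ss f) \<and>
    queries V (solve r {1..n} Ss f) \<le> sum_list (map card Ss) \<and>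
    (decision V (solve r {1..n} Ss f) \<longleftrightarrow> packable V r {1..n} 1)"
  using assms(3-5)
proof (induction Ss arbitrary: f)
  case Nil
  then show ?case by (auto simp: threshold_def one_ereal_def)
next
  case (Cons S Ss)
  have S: "finite S" "S \<noteq> {}" "S \<subseteq> {1..n}"
    using Cons.prems(2) finite_subset[of S "{1..n}"] by auto
  have th: "threshold V r (S - {i}) (f (S - {i}))" if "i \<in> S" for i
  proof -
    \<comment> \<open>The list is sorted by cardinality, so a strictly smaller set is no longer
      waiting in it.\<close>
    have "card (S - {i}) < card S" using S that by (meson card_Diff1_less)
    then have "S - {i} \<notin> set (S # Ss)" using Cons.prems(1) by auto
    then show ?thesis using Cons.prems(3)[of "S - {i}"] S by blast
  qed
  define m where "m = Min ((\<lambda>i. cut V r i (f (S - {i}))) ` S)"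
  have m: "threshold V r S m"
    unfolding m_def by (rule threshold_Min_cut) (use S v r th in auto)
  have m': "Min (insert \<infinity> ((\<lambda>i. cut V r i (f (S - {i}))) ` set (sorted_list_of_set S))) = m"
    using S by (simp add: m_def Min_insert min_def top_ereal_def[symmetric] top_unique)
  have IH: "legal n V (solve r {1..n} Ss (f(S := m))) \<and>
    queries V (solve r {1..n} Ss (f(S := m))) \<le> sum_list (map card Ss) \<and>
    (decision V (solve r {1..n} Ss (f(S := m))) \<longleftrightarrow> packable V r {1..n} 1)"
    by (rule Cons.IH) (use Cons.prems m in auto)
  have "\<And>i. i \<in> set (sorted_list_of_set S) \<Longrightarrow> 0 \<le> f (S - {i})"
    using th S by (simp add: threshold_def)
  note * = ask_correct[where n = n and V = V and m = \<infinity> and r = r and js = "sorted_list_of_set S"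
      and x = "\<lambda>i. f (S - {i})" and k = "\<lambda>m. solve r {1..n} Ss (f(S := m))", unfolded m', OF _ r this]
  show ?case using * IH S by auto
qed

section \<open>Counting the queries\<close>

lemma sum_card_Pow:
  assumes "finite A"
  shows "(\<Sum>S\<in>Pow A. card S) = card A * 2 ^ (card A - 1)"
proof -
  \<comment> \<open>The factor 2 avoids the truncated exponent \<open>card A - 1\<close>. In the
    induction every subset of \<open>A\<close> occurs once more with \<open>a\<close> added, and so
    with one more element.\<close>
  have "2 * (\<Sum>S\<in>Pow A. card S) = card A * 2 ^ card A"
    using assms
  proof (induction A rule: finite_induct)
    case empty
    then show ?case by simp
  next
    case (insert a A)
    have "(\<Sum>S\<in>insert a ` Pow A. card S) = (\<Sum>S\<in>Pow A. card (insert a S))"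
      using insert.hyps by (intro sum.reindex_cong[of "insert a"]) (auto simp: inj_on_def)
    also have "\<dots> = (\<Sum>S\<in>Pow A. Suc (card S))"
      using insert.hyps by (intro sum.cong) (auto simp: card_insert_if finite_subset)
    also have "\<dots> = (\<Sum>S\<in>Pow A. card S) + 2 ^ card A"
      using insert.hyps by (simp add: sum.distrib[of card "\<lambda>_. 1", simplified] card_Pow)
    finally have "(\<Sum>S\<in>Pow (insert a A). card S) = 2 * (\<Sum>S\<in>Pow A. card S) + 2 ^ card A"
      unfolding Pow_insert
      using insert.hyps by (subst sum.union_disjoint) auto
    then show ?case using insert by (simp add: algebra_simps)
  qed
  then show ?thesis by (cases "card A") auto
qed

theorem theorem11:
  fixes n :: nat and w :: "nat \<Rightarrow> real" and z :: real
  assumes "entitlements n w" and "0 < z"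
  shows "\<exists>alg. \<forall>V. (\<forall>i\<in>{1..n}. valuation (V i)) \<longrightarrow>
           legal n V alg \<and>
           queries V alg \<le> n * 2 ^ (n - 1) \<and>
           (decision V alg \<longleftrightarrow>
              (\<exists>X. connected_allocation n X \<and> (\<forall>i\<in>{1..n}. V i (X i) > w i + z)))"
proof -
  have n: "1 \<le> n" using assms(1) by (cases n) (auto simp: entitlements_def)
  \<comment> \<open>The value 0 outside \<open>{1..n}\<close> makes the demands nonnegative at every
    index, as the lemmas require.\<close>
  define r where "r i = (if i \<in> {1..n} then w i + z else 0)" for i
  have "0 < w i" if "i \<in> {1..n}" for i
    using assms(1) that unfolding entitlements_def by blast
  then have r: "0 \<le> r i" for i
    using assms(2) by (simp add: r_def add_nonneg_nonneg less_imp_le)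
  obtain Ss0 where Ss0: "set Ss0 = Pow {1..n} - {{}}" "distinct Ss0"
    using finite_distinct_list[of "Pow {1..n} - {{}}"] by auto
  define Ss where "Ss = sort_key card Ss0"
  have Ss: "set Ss = Pow {1..n} - {{}}" "distinct Ss" "sorted (map card Ss)"
    using Ss0 by (simp_all add: Ss_def)
  have "sum_list (map card Ss) = (\<Sum>S\<in>Pow {1..n} - {{}}. card S)"
    using Ss by (simp add: sum_list_distinct_conv_sum_set)
  also have "\<dots> = (\<Sum>S\<in>Pow {1..n}. card S)"
    by (rule sum.mono_neutral_left) auto
  also have "\<dots> = n * 2 ^ (n - 1)"
    using sum_card_Pow[of "{1..n}"] by simp
  finally have count: "sum_list (map card Ss) = n * 2 ^ (n - 1)" .
  show ?thesis
  \<comment> \<open>The tree is built from \<open>n\<close> and the demands alone, before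
    \<open>V\<close> is given. The constant table 0 satisfies the invariant because the empty set is
    the only subset outside the list.\<close>
  proof (intro exI[of _ "solve r {1..n} Ss (\<lambda>_. 0)"] allI impI)
    fix V :: "nat \<Rightarrow> real set \<Rightarrow> real"
    assume v: "\<forall>i\<in>{1..n}. valuation (V i)"
    have "legal n V (solve r {1..n} Ss (\<lambda>_. 0)) \<and>
      queries V (solve r {1..n} Ss (\<lambda>_. 0)) \<le> sum_list (map card Ss) \<and>
      (decision V (solve r {1..n} Ss (\<lambda>_. 0)) \<longleftrightarrow> packable V r {1..n} 1)"
      by (rule solve_correct) (use v r Ss threshold_empty in auto)
    moreover have "packable V r {1..n} 1 \<longleftrightarrow>
      (\<exists>X. connected_allocation n X \<and> (\<forall>i\<in>{1..n}. V i (X i) > w i + z))"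
      using connected_allocation_iff_packable[of n V r] n v r by (auto simp: r_def)
    ultimately show "legal n V (solve r {1..n} Ss (\<lambda>_. 0)) \<and>
      queries V (solve r {1..n} Ss (\<lambda>_. 0)) \<le> n * 2 ^ (n - 1) \<and>
      (decision V (solve r {1..n} Ss (\<lambda>_. 0)) \<longleftrightarrow>
        (\<exists>X. connected_allocation n X \<and> (\<forall>i\<in>{1..n}. V i (X i) > w i + z)))"
      using count by simp
  qed
qed

end
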